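(* Let $t:U\to V^*\otimes W$ be a triality of finite dimensional real vector spaces. (1) For $e_U\in U\setminus 0$ and $e_V\in V\setminus 0$, the triality algebra of $t$ at $(e_U,e_V)$ is classical if and only if the underlying triality $t$ is classical, i.e. isomorphic to precisely one of the trialities of right multiplication by real numbers, complex numbers, quaternions or octave numbers (octonions). (2) The triality algebra of $t$ associated to a choice of $e_U\in U\setminus0$ and $e_V\in V\setminus0$ is classical if and only if it is classical for any other such choice.
   Context: A linear map $t:U\to V^*\otimes W$, $u\mapsto t_u$, with $\dim U=\dim V=\dim W$, is a triality if $t_u:V\to W$ is invertible for all $u\neq0$; write $t(u,v)=t_u(v)$. Two trialities $t$ on $(U,V,W)$ and $t'$ on $(U',V',W')$ are isomorphic if there are linear isomorphisms $g_U:U\to U'$, $g_V:V\to V'$, $g_W:W\to W'$ with $t'(g_Uu,g_Vv)=g_Wt(u,v)$. For $A=\mathbb{R},\mathbb{C},\mathbb{H}$ or $\mathbb{O}$, right multiplication $u\mapsto R_u\in A^*\otimes A$ is a triality; these (up to isomorphism) are the classical trialities. Given $e_U\in U\setminus0$, $e_V\in V\setminus 0$, let $\epsilon_V:V\to W$, $\epsilon_V(v)=t(e_U,v)$ and $\epsilon_U:U\to V$, $\epsilon_U(u)=\epsilon_V^{-1}t(u,e_V)$. The triality algebra at $(e_U,e_V)$ is $V$ with the product $v_0v_1=\epsilon_V^{-1}t(\epsilon_U^{-1}(v_0),v_1)$; it is a real algebra with identity $e_V$ (not necessarily commutative or associative). For $x\in V$ let $L_x:V\to V$ be left multiplication by $x$.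 The real part of $v\in V$ is $\mathrm{Re}(v)=\mathrm{tr}(L_v)/\dim V$ (regarded as a real number or as that multiple of the identity), and $\mathrm{Im}(v)=v-\mathrm{Re}(v)$; $v$ is imaginary if $\mathrm{Re}(v)=0$. A triality algebra is classical if for every imaginary element $x$, the endomorphism $L_x^2$ is a multiple of the identity. *)

theory Defs
  imports "HOL-Analysis.Analysis"
begin

text \<open>
  A linear map \<open>U \<rightarrow> V\<^sup>* \<otimes> W\<close>, i.e. from \<open>U\<close> to the linear maps \<open>V \<rightarrow> W\<close>, is represented by
  the bilinear map \<open>t u v = t\<^sub>u(v)\<close>. The vector spaces are whole types of class \<open>real_vector\<close>.
  Finite-dimensionality is demanded explicitly, because \<open>dim\<close> is \<open>0\<close> on infinite-dimensional
  spaces.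
\<close>

definition fin_dim :: "'a::real_vector set \<Rightarrow> bool" where
  "fin_dim S \<longleftrightarrow> (\<exists>B. finite B \<and> span B = S)"

definition triality :: "('u::real_vector \<Rightarrow> 'v::real_vector \<Rightarrow> 'w::real_vector) \<Rightarrow> bool" where
  "triality t \<longleftrightarrow>
     fin_dim (UNIV :: 'u set) \<and> fin_dim (UNIV :: 'v set) \<and> fin_dim (UNIV :: 'w set) \<and>
     dim (UNIV :: 'u set) = dim (UNIV :: 'v set) \<and>
     dim (UNIV :: 'v set) = dim (UNIV :: 'w set) \<and>
     bilinear t \<and> (\<forall>u. u \<noteq> 0 \<longrightarrow> bij (t u))"

definition triality_iso ::
  "('u::real_vector \<Rightarrow> 'v::real_vector \<Rightarrow> 'w::real_vector) \<Rightarrow>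
   ('u2::real_vector \<Rightarrow> 'v2::real_vector \<Rightarrow> 'w2::real_vector) \<Rightarrow> bool" where
  "triality_iso t t' \<longleftrightarrow>
     (\<exists>gU gV gW. linear gU \<and> bij gU \<and> linear gV \<and> bij gV \<and> linear gW \<and> bij gW \<and>
        (\<forall>u v. t' (gU u) (gV v) = gW (t u v)))"


text \<open>
  Quaternions and octonions by the Cayley--Dickson construction
  \<open>(a,b)(c,d) = (ac - d\<^sup>* b, da + bc\<^sup>*)\<close>, \<open>(a,b)\<^sup>* = (a\<^sup>*, -b)\<close>, with the componentwise real vector
  space structure of the product type.
\<close>

definition cd_conj :: "('a::real_vector \<Rightarrow> 'a) \<Rightarrow> 'a \<times> 'a \<Rightarrow> 'a \<times> 'a" where
  "cd_conj cj x = (cj (fst x), - snd x)"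

definition cd_mult ::
  "('a::real_vector \<Rightarrow> 'a) \<Rightarrow> ('a \<Rightarrow> 'a \<Rightarrow> 'a) \<Rightarrow> 'a \<times> 'a \<Rightarrow> 'a \<times> 'a \<Rightarrow> 'a \<times> 'a" where
  "cd_mult cj mul x y =
     (case (x, y) of ((a, b), (c, d)) \<Rightarrow>
        (mul a c - mul (cj d) b, mul d a + mul b (cj c)))"

type_synonym quaternion = "complex \<times> complex"
type_synonym octonion = "quaternion \<times> quaternion"

definition quat_conj :: "quaternion \<Rightarrow> quaternion" where
  "quat_conj = cd_conj cnj"

definition quat_mult :: "quaternion \<Rightarrow> quaternion \<Rightarrow> quaternion" where
  "quat_mult = cd_mult cnj (*)"

definition oct_mult :: "octonion \<Rightarrow> octonion \<Rightarrow> octonion" where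
  "oct_mult = cd_mult quat_conj quat_mult"


datatype division_algebra = Real_Alg | Complex_Alg | Quaternion_Alg | Octonion_Alg

text \<open>Right multiplication \<open>R\<^sub>u(v) = vu\<close>: the index \<open>u\<close> is the right-hand factor.\<close>

primrec iso_right_mult ::
  "('u::real_vector \<Rightarrow> 'v::real_vector \<Rightarrow> 'w::real_vector) \<Rightarrow> division_algebra \<Rightarrow> bool" where
  "iso_right_mult t Real_Alg \<longleftrightarrow> triality_iso t (\<lambda>u v :: real. v * u)"
| "iso_right_mult t Complex_Alg \<longleftrightarrow> triality_iso t (\<lambda>u v :: complex. v * u)"
| "iso_right_mult t Quaternion_Alg \<longleftrightarrow> triality_iso t (\<lambda>u v :: quaternion. quat_mult v u)"
| "iso_right_mult t Octonion_Alg \<longleftrightarrow> triality_iso t (\<lambda>u v :: octonion. oct_mult v u)"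

definition classical_triality ::
  "('u::real_vector \<Rightarrow> 'v::real_vector \<Rightarrow> 'w::real_vector) \<Rightarrow> bool" where
  "classical_triality t \<longleftrightarrow> (\<exists>A. iso_right_mult t A)"


definition eps_V :: "('u \<Rightarrow> 'v \<Rightarrow> 'w) \<Rightarrow> 'u \<Rightarrow> 'v \<Rightarrow> 'w" where
  "eps_V t eU v = t eU v"

definition eps_U :: "('u \<Rightarrow> 'v \<Rightarrow> 'w) \<Rightarrow> 'u \<Rightarrow> 'v \<Rightarrow> 'u \<Rightarrow> 'v" where
  "eps_U t eU eV u = inv (eps_V t eU) (t u eV)"

definition triality_mult ::
  "('u \<Rightarrow> 'v \<Rightarrow> 'w) \<Rightarrow> 'u \<Rightarrow> 'v \<Rightarrow> 'v \<Rightarrow> 'v \<Rightarrow> 'v" where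
  "triality_mult t eU eV v0 v1 = inv (eps_V t eU) (t (inv (eps_U t eU eV) v0) v1)"


text \<open>
  Trace of an endomorphism of a finite-dimensional space, as the sum of the diagonal matrix
  entries with respect to some basis; the value does not depend on the basis.
\<close>

definition endo_trace :: "('v::real_vector \<Rightarrow> 'v) \<Rightarrow> real" where
  "endo_trace f =
     (let B = (SOME B. independent B \<and> span B = UNIV)
      in \<Sum>b\<in>B. representation B (f b) b)"

definition real_part :: "('v::real_vector \<Rightarrow> 'v \<Rightarrow> 'v) \<Rightarrow> 'v \<Rightarrow> real" where
  "real_part mul x = endo_trace (mul x) / real (dim (UNIV :: 'v set))"

definition imaginary :: "('v::real_vector \<Rightarrow> 'v \<Rightarrow> 'v) \<Rightarrow> 'v \<Rightarrow> bool" where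
  "imaginary mul x \<longleftrightarrow> real_part mul x = 0"

definition classical_algebra :: "('v::real_vector \<Rightarrow> 'v \<Rightarrow> 'v) \<Rightarrow> bool" where
  "classical_algebra mul \<longleftrightarrow>
     (\<forall>x. imaginary mul x \<longrightarrow> (\<exists>c::real. \<forall>y. mul x (mul x y) = c *\<^sub>R y))"

end

theory Submission
  imports Defs
begin

text \<open>
  A triality algebra is a unital division algebra. If it is classical, the left multiplications by
  imaginary elements satisfy the Clifford relations with respect to the quadratic form
  \<open>x \<mapsto> - x\<^sup>2\<close>, so summing a positive form over an orthonormal basis of generators produces one for
  which all these multiplications are skew. Evaluating it at the unit shows that it is proportional
  to the norm of the algebra, hence the norm is multiplicative. By Hurwitz's theorem the (opposite)
  algebra is \<open>\<real>\<close>, \<open>\<complex>\<close>, \<open>H\<close> or \<open>O\<close>.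

  Conversely, a triality isomorphic to multiplication in a composition algebra satisfies
  \<open>|t(u,v)| = |u| |v|\<close> for suitable Euclidean norms. Rescaling the norm on \<open>V\<close> so that \<open>|e\<^sub>V| = 1\<close>
  makes it multiplicative for the triality algebra at any pair of base points, and in a unital
  composition algebra trace-free left multiplications are skew and square to scalars.
\<close>

section \<open>Positive definite forms and traces\<close>

lemma fin_dim_independent_finite:
  assumes "fin_dim (UNIV :: 'v::real_vector set)" "independent (B :: 'v set)"
  shows "finite B"
proof -
  obtain C :: "'v set" where "finite C" "span C = UNIV"
    using assms(1) unfolding fin_dim_def by blast
  then show ?thesis
    using independent_span_bound[of C B] assms(2) by blast
qed

lemma fin_dim_dim_nonzero:
  fixes v :: "'v::real_vector"
  assumes "fin_dim (UNIV :: 'v set)" "v \<noteq> 0"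
  shows "dim (UNIV :: 'v set) \<noteq> 0"
proof -
  obtain B :: "'v set" where B: "independent B" "UNIV \<subseteq> span B"
    by (metis maximal_independent_subset)
  then have "dim (UNIV :: 'v set) = card B"
    by (intro dim_eq_card) (simp_all add: top.extremum_uniqueI)
  moreover have "B \<noteq> {}"
    using B(2) assms(2) by (metis UNIV_I empty_iff span_empty singletonD subsetD)
  ultimately show ?thesis
    using fin_dim_independent_finite[OF assms(1) B(1)] by auto
qed


locale positive_form =
  fixes ip :: "'v::real_vector \<Rightarrow> 'v \<Rightarrow> real"
  assumes bilinear_ip: "bilinear ip"
    and ip_commute: "ip x y = ip y x"
    and ip_pos: "x \<noteq> 0 \<Longrightarrow> ip x x > 0"
begin

lemmas ip_simps =
  bilinear_ladd[OF bilinear_ip] bilinear_radd[OF bilinear_ip]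
  bilinear_lsub[OF bilinear_ip] bilinear_rsub[OF bilinear_ip]
  bilinear_lneg[OF bilinear_ip] bilinear_rneg[OF bilinear_ip]
  bilinear_lmul[OF bilinear_ip] bilinear_rmul[OF bilinear_ip]
  bilinear_lzero[OF bilinear_ip] bilinear_rzero[OF bilinear_ip]

lemma linear_ip_left: "linear (\<lambda>x. ip x y)"
  using bilinear_ip by (simp add: bilinear_def)

lemma ip_sum_left: "ip (\<Sum>i\<in>S. f i) y = (\<Sum>i\<in>S. ip (f i) y)"
  by (rule linear_sum[OF linear_ip_left])

lemma ip_eq_0_iff: "ip x x = 0 \<longleftrightarrow> x = 0"
  using ip_pos[of x] by (cases "x = 0") (auto simp: ip_simps)

lemma ip_eqI:
  assumes "\<And>z. ip x z = ip y z"
  shows "x = y"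
  using assms[of "x - y"] ip_eq_0_iff[of "x - y"] by (simp add: ip_simps)

definition orthonormal :: "'v set \<Rightarrow> bool" where
  "orthonormal B \<longleftrightarrow> finite B \<and> (\<forall>b\<in>B. \<forall>c\<in>B. ip b c = (if b = c then 1 else 0))"

lemma orthonormal_coefficient:
  assumes "orthonormal B" "c \<in> B"
  shows "ip (\<Sum>b\<in>B. f b *\<^sub>R b) c = f c"
proof -
  have "ip (\<Sum>b\<in>B. f b *\<^sub>R b) c = (\<Sum>b\<in>B. if b = c then f b else 0)"
    unfolding ip_sum_left using assms by (intro sum.cong) (auto simp: ip_simps orthonormal_def)
  then show ?thesis
    using assms by (simp add: orthonormal_def)
qed

lemma orthonormal_expansion:
  assumes "orthonormal B" "v \<in> span B"
  shows "(\<Sum>b\<in>B. ip v b *\<^sub>R b) = v"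
proof -
  obtain f where f: "v = (\<Sum>b\<in>B. f b *\<^sub>R b)"
    using assms by (auto simp: orthonormal_def span_finite)
  then have "ip v b = f b" if "b \<in> B" for b
    using orthonormal_coefficient[OF assms(1) that] by simp
  then show ?thesis
    using f by (metis (no_types, lifting) sum.cong)
qed

text \<open>Gram-Schmidt step: subtract the projection onto the span and normalise. The span
  equality allows iteration; the doubling step of Hurwitz's theorem reuses the new vector as a unit
  normal to a subalgebra.\<close>

lemma orthonormal_extend:
  assumes B: "orthonormal B" and v: "v \<notin> span B"
  obtains u where "ip u u = 1" "\<And>b. b \<in> B \<Longrightarrow> ip u b = 0" "span (insert u B) = span (insert v B)"
proof -
  define p where "p = (\<Sum>b\<in>B. ip v b *\<^sub>R b)"
  define w where "w = v - p"
  define r where "r = sqrt (ip w w)"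
  have p: "p \<in> span B"
    unfolding p_def by (intro span_sum span_scale span_base)
  then have "w \<noteq> 0"
    using v by (auto simp: w_def)
  then have w: "ip w w > 0" and r: "r > 0"
    using ip_pos by (auto simp: r_def)
  let ?u = "inverse r *\<^sub>R w"
  have orth: "ip w b = 0" if "b \<in> B" for b
    using orthonormal_coefficient[OF B that] by (simp add: w_def p_def ip_simps)
  have "r * r = ip w w"
    using w by (simp add: r_def)
  then have "ip ?u ?u = inverse r * (inverse r * (r * r))"
    by (simp add: ip_simps)
  then have unit: "ip ?u ?u = 1"
    using r by (simp add: field_simps)
  have "v = r *\<^sub>R ?u + p"
    using r by (simp add: w_def)
  moreover have "r *\<^sub>R ?u + p \<in> span (insert ?u B)"
    using p span_mono[of B "insert ?u B"] by (intro span_add span_scale[OF span_base] insertI1) auto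
  ultimately have "v \<in> span (insert ?u B)"
    by simp
  moreover have "p \<in> span (insert v B)"
    using p span_mono[of B "insert v B"] by auto
  then have "?u \<in> span (insert v B)"
    unfolding w_def by (intro span_scale span_diff) (auto intro: span_base)
  ultimately have "span (insert ?u B) = span (insert v B)"
    by (intro subset_antisym span_minimal) (auto intro: span_base)
  then show thesis
    using that[of ?u] unit orth by (simp add: ip_simps)
qed

lemma orthonormal_basis_exists:
  assumes "finite C"
  shows "\<exists>B. orthonormal B \<and> span B = span C"
  using assms
proof (induction C)
  case empty
  then show ?case
    by (intro exI[of _ "{}"]) (simp add: orthonormal_def)
next
  case (insert c C)
  then obtain B where B: "orthonormal B" "span B = span C"
    by blast
  have span_insert_B: "span (insert c B) = span (insert c C)"
    using B(2) by (simp add: span_insert)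
  show ?case
  proof (cases "c \<in> span B")
    case True
    then have "span (insert c B) = span B"
      by (rule span_redundant)
    then show ?thesis
      using B(1) span_insert_B by metis
  next
    case False
    then obtain u where u: "ip u u = 1" "\<And>b. b \<in> B \<Longrightarrow> ip u b = 0" "span (insert u B) = span (insert c B)"
      using orthonormal_extend[OF B(1)] by metis
    have "orthonormal (insert u B)"
      using B(1) u ip_commute unfolding orthonormal_def by fastforce
    then show ?thesis
      using u(3) span_insert_B by metis
  qed
qed

text \<open>Expanding each vector of the basis chosen by \<open>endo_trace\<close> in
  \<open>B\<close> and swapping the two sums reassembles \<open>f b\<close> from its coordinates in
  that basis, so the arbitrary choice drops out.\<close>

lemma endo_trace_orthonormal:
  assumes B: "orthonormal B" "span B = UNIV" and f: "linear f"
  shows "endo_trace f = (\<Sum>b\<in>B. ip (f b) b)"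
proof -
  define C where "C = (SOME C::'v set. independent C \<and> span C = UNIV)"
  have "\<exists>C::'v set. independent C \<and> span C = UNIV"
    by (metis maximal_independent_subset top.extremum_uniqueI UNIV_I subset_UNIV)
  then have C: "independent C" "span C = UNIV"
    unfolding C_def by (metis (mono_tags, lifting) someI_ex)+
  have "finite C"
    using independent_span_bound[OF _ C(1), of B] B unfolding orthonormal_def by blast
  have "endo_trace f = (\<Sum>c\<in>C. representation C (f c) c)"
    by (simp add: endo_trace_def C_def[symmetric])
  also have "\<dots> = (\<Sum>c\<in>C. \<Sum>b\<in>B. ip c b * representation C (f b) c)"
  proof (rule sum.cong[OF refl])
    fix c
    have "f c = f (\<Sum>b\<in>B. ip c b *\<^sub>R b)"
      using orthonormal_expansion[OF B(1)] B(2) by simp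
    also have "\<dots> = (\<Sum>b\<in>B. ip c b *\<^sub>R f b)"
      by (simp add: linear_sum[OF f] linear_cmul[OF f])
    finally show "representation C (f c) c = (\<Sum>b\<in>B. ip c b * representation C (f b) c)"
      using C by (simp add: representation_sum representation_scale)
  qed
  also have "\<dots> = (\<Sum>b\<in>B. \<Sum>c\<in>C. ip c b * representation C (f b) c)"
    by (rule sum.swap)
  also have "\<dots> = (\<Sum>b\<in>B. ip (\<Sum>c\<in>C. representation C (f b) c *\<^sub>R c) b)"
    by (simp add: ip_sum_left ip_simps mult.commute)
  also have "\<dots> = (\<Sum>b\<in>B. ip (f b) b)"
    using C \<open>finite C\<close> by (simp add: sum_representation_eq)
  finally show ?thesis .
qed

end

lemma positive_form_inner: "positive_form ((\<bullet>) :: 'a::euclidean_space \<Rightarrow> 'a \<Rightarrow> real)"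
  by unfold_locales
    (auto simp: bilinear_def inner_commute intro!: linearI simp: inner_add_left inner_add_right)


section \<open>Composition algebras\<close>

locale composition_algebra = positive_form ip
  for ip :: "'v::real_vector \<Rightarrow> 'v \<Rightarrow> real" +
  fixes mul :: "'v \<Rightarrow> 'v \<Rightarrow> 'v" (infixl \<open>\<odot>\<close> 70) and e :: 'v
  assumes bilinear_mul: "bilinear mul"
    and unit_left: "e \<odot> x = x"
    and unit_right: "x \<odot> e = x"
    and unit_nonzero: "e \<noteq> 0"
    and ip_mul: "ip (x \<odot> y) (x \<odot> y) = ip x x * ip y y"
begin

lemmas mul_simps =
  bilinear_ladd[OF bilinear_mul] bilinear_radd[OF bilinear_mul]
  bilinear_lsub[OF bilinear_mul] bilinear_rsub[OF bilinear_mul]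
  bilinear_lneg[OF bilinear_mul] bilinear_rneg[OF bilinear_mul]
  bilinear_lmul[OF bilinear_mul] bilinear_rmul[OF bilinear_mul]
  bilinear_lzero[OF bilinear_mul] bilinear_rzero[OF bilinear_mul]
  unit_left unit_right

lemma ip_unit: "ip e e = 1"
  using ip_mul[of e e] ip_pos[OF unit_nonzero] by (simp add: unit_left)

lemma ip_mul_left: "ip (x \<odot> y) (x \<odot> z) = ip x x * ip y z"
  using ip_mul[of x "y + z"] ip_mul[of x y] ip_mul[of x z]
    ip_commute[of z y] ip_commute[of "x \<odot> z" "x \<odot> y"]
  by (simp add: ip_simps mul_simps algebra_simps)

text \<open>Full polarisation of \<open>ip_mul\<close>, obtained in one factor after the other.
  Setting a factor to \<open>e\<close> yields both adjoint laws, which do the work of associativity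
  in what follows.\<close>

lemma ip_exchange: "ip (x \<odot> y) (w \<odot> z) + ip (x \<odot> z) (w \<odot> y) = 2 * ip x w * ip y z"
  using ip_mul_left[of "x + w" y z] ip_mul_left[of x y z] ip_mul_left[of w y z]
    ip_commute[of w x] ip_commute[of "w \<odot> y" "x \<odot> z"]
  by (simp add: ip_simps mul_simps algebra_simps)

lemma ip_mul_right: "ip (x \<odot> y) (w \<odot> y) = ip x w * ip y y"
  using ip_exchange[of x y w y] by simp

definition conjugate :: "'v \<Rightarrow> 'v" where
  "conjugate x = (2 * ip x e) *\<^sub>R e - x"

lemma ip_left_adjoint: "ip (x \<odot> y) z = ip y (conjugate x \<odot> z)"
  using ip_exchange[of x y e z] ip_commute[of y "x \<odot> z"]
  by (simp add: conjugate_def ip_simps mul_simps algebra_simps)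

lemma ip_right_adjoint: "ip (x \<odot> y) z = ip x (z \<odot> conjugate y)"
  using ip_exchange[of x y z e]
  by (simp add: conjugate_def ip_simps mul_simps algebra_simps)

lemma conjugate_conjugate: "conjugate (conjugate x) = x"
  by (simp add: conjugate_def ip_simps ip_unit scaleR_add_left[symmetric] algebra_simps)

lemma ip_conjugate_left: "ip (conjugate x) y = ip x (conjugate y)"
  using ip_commute[of e y] by (simp add: conjugate_def ip_simps algebra_simps)

text \<open>The form is nondegenerate, so it suffices to pair with an arbitrary \<open>z\<close>.
  The adjoint laws then carry the factors across the form one at a time, without any
  reassociation.\<close>

lemma conjugate_mul: "conjugate (x \<odot> y) = conjugate y \<odot> conjugate x"
proof (rule ip_eqI)
  fix z
  have "ip (conjugate (x \<odot> y)) z = ip y (conjugate x \<odot> conjugate z)"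
    by (simp add: ip_conjugate_left ip_left_adjoint)
  also have "\<dots> = ip (y \<odot> z) (conjugate x)"
    by (simp add: ip_right_adjoint)
  also have "\<dots> = ip (conjugate y \<odot> conjugate x) z"
    by (simp add: ip_left_adjoint ip_commute)
  finally show "ip (conjugate (x \<odot> y)) z = ip (conjugate y \<odot> conjugate x) z" .
qed

lemma mul_mul_conjugate: "(x \<odot> y) \<odot> conjugate y = ip y y *\<^sub>R x"
proof (rule ip_eqI)
  fix z
  have "ip ((x \<odot> y) \<odot> conjugate y) z = ip (z \<odot> y) (x \<odot> y)"
    by (simp add: ip_right_adjoint ip_commute[of _ z])
  also have "\<dots> = ip (ip y y *\<^sub>R x) z"
    by (simp add: ip_mul_right ip_simps ip_commute[of x])
  finally show "ip ((x \<odot> y) \<odot> conjugate y) z = ip (ip y y *\<^sub>R x) z" .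
qed

text \<open>For \<open>x\<close> orthogonal to \<open>e\<close>, \<open>conjugate x = - x\<close>
  makes left multiplication by \<open>x\<close> skew. It also scales the form by
  \<open>ip x x\<close>, and together these determine its square.\<close>

lemma left_mul_square:
  assumes "ip x e = 0"
  shows "x \<odot> (x \<odot> y) = (- ip x x) *\<^sub>R y"
proof (rule ip_eqI)
  fix z
  have "ip (x \<odot> (x \<odot> y)) z = - ip (x \<odot> y) (x \<odot> z)"
    using assms by (simp add: ip_left_adjoint[of x "x \<odot> y"] conjugate_def mul_simps ip_simps)
  then show "ip (x \<odot> (x \<odot> y)) z = ip ((- ip x x) *\<^sub>R y) z"
    by (simp add: ip_mul_left ip_simps)
qed

text \<open>In an orthonormal basis all diagonal entries agree, because
  \<open>ip (x \<odot> b) (e \<odot> b) = ip x e * ip b b\<close>. Hence the imaginary elements are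
  those orthogonal to \<open>e\<close>, as \<open>left_mul_square\<close> demands.\<close>

lemma endo_trace_left_mul:
  assumes "fin_dim (UNIV :: 'v set)"
  shows "endo_trace ((\<odot>) x) = real (dim (UNIV :: 'v set)) * ip x e"
proof -
  obtain C :: "'v set" where "finite C" "span C = UNIV"
    using assms by (auto simp: fin_dim_def)
  then obtain B where B: "orthonormal B" "span B = UNIV"
    using orthonormal_basis_exists by metis
  \<comment> \<open>Towards independence of \<open>B\<close>: a member lying in the span of the
    others would have only zero coefficients there, while no member of \<open>B\<close> is
    zero.\<close>
  have "b = 0" if "b \<in> B" "b \<in> span (B - {b})" for b
  proof -
    have "orthonormal (B - {b})"
      using B by (auto simp: orthonormal_def)
    then have "b = (\<Sum>c\<in>B - {b}. ip b c *\<^sub>R c)"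
      using orthonormal_expansion that by metis
    also have "\<dots> = 0"
      using B that by (intro sum.neutral) (auto simp: orthonormal_def)
    finally show ?thesis .
  qed
  moreover have "0 \<notin> B"
    using B(1) bilinear_lzero[OF bilinear_ip, of 0] unfolding orthonormal_def by (metis zero_neq_one)
  ultimately have "independent B"
    unfolding dependent_def by metis
  then have dim: "dim (UNIV :: 'v set) = card B"
    using B(2) dim_eq_card[of B UNIV] by simp
  have diag: "ip (x \<odot> b) b = ip x e" if "b \<in> B" for b
    using B that ip_mul_right[of x b e] by (auto simp: orthonormal_def unit_left)
  have "linear ((\<odot>) x)"
    using bilinear_mul by (simp add: bilinear_def)
  then have "endo_trace ((\<odot>) x) = (\<Sum>b\<in>B. ip (x \<odot> b) b)"
    using endo_trace_orthonormal[OF B] by blast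
  then show ?thesis
    by (simp add: diag dim)
qed

lemma classical_mul:
  assumes "fin_dim (UNIV :: 'v set)"
  shows "classical_algebra (\<odot>)"
proof -
  have "dim (UNIV :: 'v set) \<noteq> 0"
    using fin_dim_dim_nonzero[OF assms unit_nonzero] .
  then show ?thesis
    unfolding classical_algebra_def imaginary_def real_part_def
    using endo_trace_left_mul[OF assms] left_mul_square by (metis mult_cancel_left nonzero_mult_div_cancel_left of_nat_eq_0_iff)
qed

end


section \<open>Clifford relations give a multiplicative norm\<close>

text \<open>The products of distinct \<open>J i\<close>, together with their negatives, form a
  finite group. The induction sums \<open>h0\<close> over these products, which is averaging over
  the group up to a positive factor.\<close>

lemma anticommuting_invariant_form:
  fixes J :: "'i \<Rightarrow> 'v::real_vector \<Rightarrow> 'v" and h0 :: "'v \<Rightarrow> 'v \<Rightarrow> real"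
  assumes "finite E" and h0: "positive_form h0"
    and "\<And>i. i \<in> E \<Longrightarrow> linear (J i)"
    and "\<And>i y. i \<in> E \<Longrightarrow> J i (J i y) = - y"
    and "\<And>i j y. i \<in> E \<Longrightarrow> j \<in> E \<Longrightarrow> i \<noteq> j \<Longrightarrow> J i (J j y) = - J j (J i y)"
  shows "\<exists>h. positive_form h \<and> (\<forall>i\<in>E. \<forall>y z. h (J i y) (J i z) = h y z)"
  using assms(1,3-)
proof (induction E)
  case empty
  show ?case
    by (intro exI[of _ h0]) (simp add: h0)
next
  case (insert k E)
  then obtain h where h: "positive_form h" "\<And>i y z. i \<in> E \<Longrightarrow> h (J i y) (J i z) = h y z"
    by (metis insertCI)
  interpret h: positive_form h
    by (rule h(1))
  have lin: "linear (J k)"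
    using insert by blast
  txt \<open>Anticommutation makes the signs cancel, so the forms invariant under the previous \<open>J i\<close> stay so.\<close>
  define g where "g y z = h y z + h (J k y) (J k z)" for y z
  have nonneg: "h y y \<ge> 0" for y
    using h.ip_pos[of y] by (cases "y = 0") (auto simp: h.ip_simps)
  have "positive_form g"
  proof
    show "bilinear g"
      by (auto simp: bilinear_def g_def h.ip_simps linear_add[OF lin] linear_cmul[OF lin] algebra_simps
          intro!: linearI)
    show "g x y = g y x" for x y
      by (simp add: g_def h.ip_commute)
    show "g x x > 0" if "x \<noteq> 0" for x
      using h.ip_pos[OF that] nonneg[of "J k x"] by (simp add: g_def)
  qed
  moreover have "g (J i y) (J i z) = g y z" if "i \<in> insert k E" for i y z
  proof (cases "i = k")
    case True
    then show ?thesis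
      using insert.prems(2)[of k] by (simp add: g_def h.ip_simps)
  next
    case False
    then have "J k (J i x) = - J i (J k x)" for x
      using insert.prems(3)[of k i] that by auto
    then show ?thesis
      using False that h(2) by (simp add: g_def h.ip_simps)
  qed
  ultimately show ?case
    by blast
qed

text \<open>\<open>endo_trace\<close> picks its basis independently of the endomorphism, so one
  basis serves all \<open>x\<close>, and each diagonal coordinate is linear in
  \<open>x\<close>.\<close>

lemma real_part_linear:
  assumes "bilinear (mul :: 'v::real_vector \<Rightarrow> 'v \<Rightarrow> 'v)"
  shows "linear (real_part mul)"
proof -
  define B where "B = (SOME B::'v set. independent B \<and> span B = UNIV)"
  have "\<exists>B::'v set. independent B \<and> span B = UNIV"
    by (metis maximal_independent_subset top.extremum_uniqueI)
  then have B: "independent B" "span B = UNIV"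
    unfolding B_def by (metis (mono_tags, lifting) someI_ex)+
  have "real_part mul x = (\<Sum>b\<in>B. representation B (mul x b) b) / real (dim (UNIV :: 'v set))" for x
    by (simp add: real_part_def endo_trace_def B_def[symmetric])
  then show ?thesis
    using B by (intro linearI)
      (simp_all add: bilinear_ladd[OF assms] bilinear_lmul[OF assms] representation_add
        representation_scale sum.distrib add_divide_distrib sum_distrib_left)
qed

lemma real_part_unit:
  fixes e :: "'v::real_vector"
  assumes "fin_dim (UNIV :: 'v set)" "e \<noteq> 0" "\<And>x. mul e x = x"
  shows "real_part mul e = 1"
proof -
  define B where "B = (SOME B::'v set. independent B \<and> span B = UNIV)"
  have "\<exists>B::'v set. independent B \<and> span B = UNIV"
    by (metis maximal_independent_subset top.extremum_uniqueI)
  then have B: "independent B" "span B = UNIV"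
    unfolding B_def by (metis (mono_tags, lifting) someI_ex)+
  have "endo_trace (mul e) = (\<Sum>b\<in>B. representation B b b)"
    by (simp add: endo_trace_def B_def[symmetric] assms)
  also have "\<dots> = real (card B)"
    using B by (simp add: representation_basis)
  also have "card B = dim (UNIV :: 'v set)"
    using dim_eq_card[of B UNIV] B by simp
  finally show ?thesis
    using fin_dim_dim_nonzero[OF assms(1,2)] by (simp add: real_part_def)
qed

theorem classical_division_algebra_is_composition_algebra:
  fixes mul :: "'v::real_vector \<Rightarrow> 'v \<Rightarrow> 'v" (infixl \<open>\<odot>\<close> 70)
  assumes fin: "fin_dim (UNIV :: 'v set)" and bil: "bilinear (\<odot>)"
    and unit: "\<And>x. e \<odot> x = x" "\<And>x. x \<odot> e = x" and "e \<noteq> 0"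
    and div: "\<And>x y. x \<odot> y = 0 \<Longrightarrow> x = 0 \<or> y = 0"
    and classical: "classical_algebra (\<odot>)"
  shows "\<exists>ip. composition_algebra ip (\<odot>) e"
proof -
  note mul_simps =
    bilinear_ladd[OF bil] bilinear_radd[OF bil] bilinear_lsub[OF bil] bilinear_rsub[OF bil]
    bilinear_lneg[OF bil] bilinear_rneg[OF bil] bilinear_lmul[OF bil] bilinear_rmul[OF bil]
    bilinear_lzero[OF bil] bilinear_rzero[OF bil] unit
  define \<rho> where "\<rho> = real_part (\<odot>)"
  have lin: "linear \<rho>"
    unfolding \<rho>_def by (rule real_part_linear[OF bil])
  note \<rho>_simps = linear_add[OF lin] linear_diff[OF lin] linear_cmul[OF lin, unfolded real_scaleR_def]
    linear_neg[OF lin] linear_0[OF lin]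
  have \<rho>_unit: "\<rho> e = 1"
    unfolding \<rho>_def using real_part_unit[OF fin \<open>e \<noteq> 0\<close>] unit(1) by blast
  \<comment> \<open>This is the polarisation of \<open>- \<rho> (x \<odot> x)\<close>. For imaginary
    \<open>x\<close> with square \<open>c *\<^sub>R e\<close> its diagonal value is
    \<open>- c\<close>, since \<open>\<rho> e = 1\<close>.\<close>
  define b where "b x y = - (\<rho> (x \<odot> y) + \<rho> (y \<odot> x)) / 2" for x y
  have b_commute: "b x y = b y x" for x y
    by (simp add: b_def)
  have b_bil: "bilinear b"
    by (auto simp: bilinear_def b_def mul_simps \<rho>_simps field_simps intro!: linearI)
  note b_simps =
    bilinear_ladd[OF b_bil] bilinear_radd[OF b_bil] bilinear_lsub[OF b_bil] bilinear_rsub[OF b_bil]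
    bilinear_lneg[OF b_bil] bilinear_rneg[OF b_bil] bilinear_lmul[OF b_bil] bilinear_rmul[OF b_bil]
    bilinear_lzero[OF b_bil] bilinear_rzero[OF b_bil]
  have square: "x \<odot> (x \<odot> y) = (- b x x) *\<^sub>R y" if "\<rho> x = 0" for x y
  proof -
    have "imaginary (\<odot>) x"
      using that by (simp add: imaginary_def \<rho>_def)
    then obtain c where c: "\<And>y. x \<odot> (x \<odot> y) = c *\<^sub>R y"
      using classical unfolding classical_algebra_def by blast
    have "x \<odot> x = c *\<^sub>R e"
      using c[of e] by (simp add: unit)
    then show ?thesis
      by (simp add: b_def c \<rho>_simps \<rho>_unit)
  qed
  \<comment> \<open>If \<open>b x x \<le> 0\<close>, then \<open>x \<odot> x\<close> is a
    nonnegative multiple \<open>s * s\<close> of \<open>e\<close> and factors as a difference of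
    squares. Without zero divisors \<open>x\<close> is a multiple of \<open>e\<close>, which real
    part zero forces to vanish.\<close>
  have b_pos: "b x x > 0" if "\<rho> x = 0" "x \<noteq> 0" for x
  proof (rule ccontr)
    assume neg: "\<not> b x x > 0"
    define s where "s = sqrt (- b x x)"
    have "s * s = - b x x"
      using neg by (simp add: s_def)
    moreover have "x \<odot> x = (- b x x) *\<^sub>R e"
      using square[OF that(1), of e] by (simp add: unit)
    ultimately have "(x - s *\<^sub>R e) \<odot> (x + s *\<^sub>R e) = 0"
      by (simp add: mul_simps algebra_simps)
    then consider "x = s *\<^sub>R e" | "x = (- s) *\<^sub>R e"
      using div[of "x - s *\<^sub>R e" "x + s *\<^sub>R e"] by (auto simp: add_eq_0_iff)
    then show False
      using that by cases (auto simp: \<rho>_simps \<rho>_unit)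
  qed
  have anticommute: "x \<odot> (y \<odot> z) + y \<odot> (x \<odot> z) + (2 * b x y) *\<^sub>R z = 0"
    if "\<rho> x = 0" "\<rho> y = 0" for x y z
  proof -
    have "(x + y) \<odot> ((x + y) \<odot> z) = (- b (x + y) (x + y)) *\<^sub>R z"
      using that by (intro square) (simp add: \<rho>_simps)
    then show ?thesis
      using square[OF that(1), of z] square[OF that(2), of z] b_commute[of x y]
      by (simp add: mul_simps b_simps algebra_simps)
  qed
  define P where "P v = v - \<rho> v *\<^sub>R e" for v
  have P: "linear P" "\<rho> (P v) = 0" "v = \<rho> v *\<^sub>R e + P v" for v
    by (auto simp: P_def \<rho>_simps \<rho>_unit algebra_simps intro!: linearI)
  \<comment> \<open>The candidate norm: \<open>e\<close> has length one and is orthogonal to the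
    imaginary part, on which \<open>N\<close> agrees with \<open>b\<close>.\<close>
  define N where "N x y = \<rho> x * \<rho> y + b (P x) (P y)" for x y
  have N: "positive_form N"
  proof
    show "bilinear N"
      by (auto simp: bilinear_def N_def b_simps \<rho>_simps linear_add[OF P(1)] linear_cmul[OF P(1)]
          algebra_simps intro!: linearI)
    show "N x y = N y x" for x y
      by (simp add: N_def b_commute mult.commute)
    show "N x x > 0" if "x \<noteq> 0" for x
    proof (cases "P x = 0")
      case True
      then have "\<rho> x \<noteq> 0"
        using P(3)[of x] that by auto
      then show ?thesis
        using True by (auto simp: N_def b_simps zero_less_mult_iff)
    next
      case False
      then show ?thesis
        using b_pos[of "P x"] P(2) by (simp add: N_def add_nonneg_pos)
    qed
  qed
  interpret N: positive_form N
    by (rule N)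
  obtain C :: "'v set" where C: "finite C" "span C = UNIV"
    using fin by (auto simp: fin_dim_def)
  obtain E where E: "N.orthonormal E" "span E = span (P ` C)"
    using N.orthonormal_basis_exists[of "P ` C"] C by auto
  have span_E: "span E = range P"
    using E(2) C(2) linear_span_image[OF P(1), of C] by simp
  then have E_im: "\<rho> x = 0" "P x = x" if "x \<in> span E" for x
    using that P(2) by (auto simp: P_def)
  have N_E: "b x y = (if x = y then 1 else 0)" if "x \<in> E" "y \<in> E" for x y
    using E(1) E_im that span_base[of _ E] unfolding N.orthonormal_def N_def by (metis add_0 mult_zero_left)
  \<comment> \<open>\<open>E\<close> is an orthonormal basis of the imaginary part, so
    \<open>square\<close> and \<open>anticommute\<close> turn the left multiplications by its
    members into Clifford generators.\<close>
  have "\<exists>h. positive_form h \<and> (\<forall>i\<in>E. \<forall>y z. h (i \<odot> y) (i \<odot> z) = h y z)"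
  proof (rule anticommuting_invariant_form[OF _ N])
    show "finite E"
      using E(1) by (simp add: N.orthonormal_def)
    show "linear ((\<odot>) i)" for i
      using bil by (simp add: bilinear_def)
    show "i \<odot> (i \<odot> y) = - y" if "i \<in> E" for i y
      using square[of i y] E_im(1) span_base[of i E] that N_E[of i i] by simp
    show "i \<odot> (j \<odot> y) = - (j \<odot> (i \<odot> y))" if "i \<in> E" "j \<in> E" "i \<noteq> j" for i j y
      using anticommute[of i j y] E_im(1) span_base[of i E] span_base[of j E] that N_E[of i j]
      by (simp add: eq_neg_iff_add_eq_0)
  qed
  then obtain h where h: "positive_form h" "\<And>i y z. i \<in> E \<Longrightarrow> h (i \<odot> y) (i \<odot> z) = h y z"
    by blast
  interpret h: positive_form h
    by (rule h(1))
  \<comment> \<open>An isometry with square \<open>-1\<close> is skew. Unlike being an isometry,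
    skewness is linear in \<open>x\<close> and so passes from the generators to the whole imaginary
    part.\<close>
  have skew: "h (x \<odot> y) z = - h y (x \<odot> z)" if "x \<in> span E" for x y z
    using that
  proof (induction rule: span_induct)
    case base
    show ?case
      by (auto simp: subspace_def mul_simps h.ip_simps algebra_simps)
  next
    case (step i)
    have "i \<odot> (i \<odot> y) = - y"
      using square[of i y] E_im(1) span_base[of i E] step N_E[of i i] by simp
    then show ?case
      using h(2)[OF step, of "i \<odot> y" z] by (simp add: h.ip_simps)
  qed
  \<comment> \<open>Split \<open>x\<close> into its real part and \<open>P x\<close>. Skewness kills
    the cross terms and \<open>square\<close> evaluates the remaining term. This is multiplicativity
    with two different forms, \<open>N\<close> and \<open>h\<close>.\<close>
  have h_mul: "h (x \<odot> y) (x \<odot> y) = N x x * h y y" for x y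
  proof -
    have Px: "P x \<in> span E"
      by (simp add: span_E)
    have "h (P x \<odot> y) (P x \<odot> y) = b (P x) (P x) * h y y"
      using skew[OF Px, of y "P x \<odot> y"] square[OF P(2), of x y] by (simp add: h.ip_simps)
    moreover have "h y (P x \<odot> y) = 0" "h (P x \<odot> y) y = 0"
      using skew[OF Px, of y y] h.ip_commute[of y "P x \<odot> y"] by auto
    moreover have "x \<odot> y = \<rho> x *\<^sub>R y + P x \<odot> y"
      by (subst P(3)) (simp add: mul_simps)
    ultimately show ?thesis
      by (simp add: h.ip_simps N_def algebra_simps)
  qed
  \<comment> \<open>Evaluating at \<open>y = e\<close> shows that \<open>h\<close> and
    \<open>N\<close> are proportional on the diagonal; cancelling the positive number
    \<open>h e e\<close> then makes \<open>N\<close> itself multiplicative.\<close>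
  have h_eq_N: "h x x = N x x * h e e" for x
    using h_mul[of x e] by (simp add: unit)
  have "composition_algebra N (\<odot>) e"
  proof
    show "N (x \<odot> y) (x \<odot> y) = N x x * N y y" for x y
      using h_mul[of x y] h_eq_N[of "x \<odot> y"] h_eq_N[of y] h.ip_pos[OF \<open>e \<noteq> 0\<close>] by simp
  qed (use bil unit \<open>e \<noteq> 0\<close> in auto)
  then show ?thesis
    by blast
qed


section \<open>Hurwitz's theorem\<close>

context composition_algebra
begin

text \<open>The conjugation is carried along because the Cayley-Dickson product needs it. The source
  has no named unit, so unitality is expressed by \<open>e\<close> lying in the range.\<close>

definition comp_embedding :: "('a::euclidean_space \<Rightarrow> 'a) \<Rightarrow> ('a \<Rightarrow> 'a \<Rightarrow> 'a) \<Rightarrow> ('a \<Rightarrow> 'v) \<Rightarrow> bool" where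
  "comp_embedding cj m \<phi> \<longleftrightarrow>
     linear \<phi> \<and> (\<forall>a b. \<phi> (m a b) = \<phi> a \<odot> \<phi> b) \<and> (\<forall>a b. ip (\<phi> a) (\<phi> b) = a \<bullet> b) \<and>
     (\<forall>a. \<phi> (cj a) = conjugate (\<phi> a)) \<and> e \<in> range \<phi>"

lemma comp_embedding_inj:
  assumes "comp_embedding cj m \<phi>"
  shows "inj \<phi>"
proof (rule injI)
  fix a b
  assume "\<phi> a = \<phi> b"
  then have "ip (\<phi> (a - b)) (\<phi> (a - b)) = 0"
    using assms by (simp add: comp_embedding_def linear_diff ip_simps)
  then show "a = b"
    using assms by (simp add: comp_embedding_def)
qed

lemma comp_embedding_norm_mul:
  assumes "comp_embedding cj m \<phi>"
  shows "m a b \<bullet> m a b = (a \<bullet> a) * (b \<bullet> b)"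
  using assms ip_mul unfolding comp_embedding_def by metis

text \<open>For a unit vector \<open>u\<close> orthogonal to the image \<open>A\<close>, the sum of
  \<open>A\<close> and \<open>A \<odot> u\<close> is orthogonal and multiplies by the Cayley-Dickson
  rule. The three mixed products are \<open>mul1\<close>, \<open>mul2\<close> and
  \<open>mul3\<close>.\<close>

lemma comp_embedding_double:
  assumes "comp_embedding cj m \<phi>" "\<not> surj \<phi>"
  shows "\<exists>\<psi>. comp_embedding (cd_conj cj) (cd_mult cj m) \<psi>"
proof -
  have lin: "linear \<phi>" and hom: "\<phi> (m a b) = \<phi> a \<odot> \<phi> b" and iso: "ip (\<phi> a) (\<phi> b) = a \<bullet> b"
    and cj: "\<phi> (cj a) = conjugate (\<phi> a)" and e: "e \<in> range \<phi>" for a b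
    using assms(1) by (auto simp: comp_embedding_def)
  have "orthonormal (\<phi> ` Basis)"
    by (auto simp: orthonormal_def iso inner_Basis inj_eq[OF comp_embedding_inj[OF assms(1)]])
  moreover have span: "span (\<phi> ` Basis) = range \<phi>"
    using linear_span_image[OF lin, of Basis] by simp
  moreover obtain v where "v \<notin> range \<phi>"
    using assms(2) by auto
  ultimately obtain u where u: "ip u u = 1" "\<And>b. b \<in> \<phi> ` Basis \<Longrightarrow> ip u b = 0"
    using orthonormal_extend by metis
  have "ip u x = 0" if "x \<in> range \<phi>" for x
    using that unfolding span[symmetric]
    by (induction rule: span_induct) (auto simp: subspace_def ip_simps u)
  then have orth: "ip u (\<phi> a) = 0" "ip (\<phi> a) u = 0" for a
    using ip_commute[of "\<phi> a" u] by auto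
  have orth_e: "ip u e = 0" "ip e u = 0"
    using e orth by auto
  have conj_u: "conjugate u = - u"
    by (simp add: conjugate_def orth_e)
  have conj_mul_u: "conjugate (\<phi> a \<odot> u) = - (\<phi> a \<odot> u)" for a
    using ip_left_adjoint[of "\<phi> a" u e] orth(1)[of "cj a"] by (simp add: conjugate_def[of "\<phi> a \<odot> u"] cj unit_right)
  \<comment> \<open>Elements of the form \<open>\<phi> a \<odot> u\<close> are orthogonal to
    \<open>e\<close>, so conjugation negates them; conjugating such a product by the
    antiautomorphism law moves \<open>u\<close> to the other side.\<close>
  have swap: "u \<odot> \<phi> a = conjugate (\<phi> a) \<odot> u" for a
    using conj_mul_u[of "cj a"] conjugate_mul[of "conjugate (\<phi> a)" u]
    by (simp add: cj conjugate_conjugate conj_u mul_simps)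
  have conj_add: "\<phi> a + conjugate (\<phi> a) = (2 * ip (\<phi> a) e) *\<^sub>R e" for a
    by (simp add: conjugate_def)
  \<comment> \<open>Paired with \<open>t\<close>, the left side is rewritten by two uses of
    \<open>ip_exchange\<close>. The resulting trace term combines with the conjugate of
    \<open>?p\<close> to leave \<open>?p\<close> alone.\<close>
  have mul1: "\<phi> a \<odot> (\<phi> d \<odot> u) = (\<phi> d \<odot> \<phi> a) \<odot> u" for a d
  proof (rule ip_eqI)
    fix t
    let ?p = "\<phi> (m d a)"
    have "ip (\<phi> a \<odot> (\<phi> d \<odot> u)) t = ip (\<phi> d \<odot> u) (conjugate (\<phi> a) \<odot> t)"
      by (rule ip_left_adjoint)
    also have "\<dots> = 2 * ip (\<phi> d) (conjugate (\<phi> a)) * ip u t - ip (\<phi> d \<odot> t) (conjugate (\<phi> a) \<odot> u)"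
      using ip_exchange[of "\<phi> d" u "conjugate (\<phi> a)" t] by simp
    also have "ip (\<phi> d \<odot> t) (conjugate (\<phi> a) \<odot> u) = - ip ?p (u \<odot> t)"
      using ip_exchange[of "\<phi> d" t u "\<phi> a"] by (simp add: swap[symmetric] hom orth)
    also have "ip ?p (u \<odot> t) = - ip (conjugate ?p \<odot> u) t"
      using ip_left_adjoint[of u t ?p] ip_commute[of "u \<odot> t" ?p] ip_commute[of t "u \<odot> ?p"]
      by (simp add: conj_u mul_simps ip_simps swap)
    also have "ip (\<phi> d) (conjugate (\<phi> a)) = ip ?p e"
      using ip_right_adjoint[of "\<phi> d" "\<phi> a" e] by (simp add: hom unit_left)
    also have "2 * ip ?p e * ip u t - (- (- ip (conjugate ?p \<odot> u) t)) = ip ((?p + conjugate ?p) \<odot> u - conjugate ?p \<odot> u) t"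
      unfolding conj_add by (simp add: mul_simps ip_simps)
    also have "\<dots> = ip ((\<phi> d \<odot> \<phi> a) \<odot> u) t"
      by (simp add: mul_simps hom)
    finally show "ip (\<phi> a \<odot> (\<phi> d \<odot> u)) t = ip ((\<phi> d \<odot> \<phi> a) \<odot> u) t" .
  qed
  \<comment> \<open>This is \<open>mul1\<close> after conjugation.\<close>
  have mul2: "(\<phi> b \<odot> u) \<odot> \<phi> c = (\<phi> b \<odot> conjugate (\<phi> c)) \<odot> u" for b c
  proof -
    have "conjugate ((\<phi> b \<odot> u) \<odot> \<phi> c) = - (\<phi> (cj c) \<odot> (\<phi> b \<odot> u))"
      by (simp add: conjugate_mul[of "\<phi> b \<odot> u"] conj_mul_u mul_simps cj)
    also have "\<dots> = - (\<phi> (m b (cj c)) \<odot> u)"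
      by (simp add: mul1 hom)
    also have "\<dots> = conjugate (\<phi> (m b (cj c)) \<odot> u)"
      by (simp add: conj_mul_u)
    finally show ?thesis
      by (metis conjugate_conjugate hom cj)
  qed
  have mul3: "(\<phi> b \<odot> u) \<odot> (\<phi> d \<odot> u) = - (conjugate (\<phi> d) \<odot> \<phi> b)" for b d
  proof (rule ip_eqI)
    fix t
    have "ip ((\<phi> b \<odot> u) \<odot> (\<phi> d \<odot> u)) t = - ip (\<phi> d \<odot> u) ((\<phi> b \<odot> u) \<odot> t)"
      by (simp add: ip_left_adjoint[of "\<phi> b \<odot> u"] conj_mul_u mul_simps ip_simps)
    also have "\<dots> = - (2 * ip (\<phi> d) (\<phi> b \<odot> u) * ip u t) + ip (\<phi> d \<odot> t) ((\<phi> b \<odot> u) \<odot> u)"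
      using ip_exchange[of "\<phi> d" u "\<phi> b \<odot> u" t] by simp
    also have "ip (\<phi> d) (\<phi> b \<odot> u) = 0"
      using ip_left_adjoint[of "\<phi> b" u "\<phi> d"] ip_commute[of "\<phi> d" "\<phi> b \<odot> u"] orth(1)[of "m (cj b) d"]
      by (simp add: hom cj)
    also have "(\<phi> b \<odot> u) \<odot> u = - \<phi> b"
      using mul_mul_conjugate[of "\<phi> b" u] by (simp add: conj_u mul_simps u(1) minus_equation_iff)
    also have "- (2 * 0 * ip u t) + ip (\<phi> d \<odot> t) (- \<phi> b) = ip (- (conjugate (\<phi> d) \<odot> \<phi> b)) t"
      using ip_left_adjoint[of "\<phi> d" t "\<phi> b"] ip_commute[of t "conjugate (\<phi> d) \<odot> \<phi> b"]
      by (simp add: ip_simps)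
    finally show "ip ((\<phi> b \<odot> u) \<odot> (\<phi> d \<odot> u)) t = ip (- (conjugate (\<phi> d) \<odot> \<phi> b)) t" .
  qed
  define \<psi> where "\<psi> x = \<phi> (fst x) + \<phi> (snd x) \<odot> u" for x
  have "linear \<psi>"
    by (intro linearI) (simp_all add: \<psi>_def linear_add[OF lin] linear_cmul[OF lin] mul_simps algebra_simps)
  moreover have "\<psi> (cd_mult cj m x y) = \<psi> x \<odot> \<psi> y" for x y
    by (cases x; cases y)
      (simp add: \<psi>_def cd_mult_def linear_add[OF lin] linear_diff[OF lin] hom cj mul_simps mul1 mul2 mul3)
  moreover have "ip (\<psi> x) (\<psi> y) = x \<bullet> y" for x y
  proof -
    have "ip (\<phi> b \<odot> u) (\<phi> a) = 0" "ip (\<phi> a) (\<phi> b \<odot> u) = 0" for a b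
      using ip_left_adjoint[of "\<phi> b" u "\<phi> a"] orth(1)[of "m (cj b) a"] ip_commute[of "\<phi> a"]
      by (simp_all add: hom cj)
    then show ?thesis
      by (simp add: \<psi>_def ip_simps ip_mul_right u(1) iso inner_prod_def)
  qed
  moreover have "\<psi> (cd_conj cj x) = conjugate (\<psi> x)" for x
  proof -
    have "conjugate (\<phi> a + \<phi> b \<odot> u) = conjugate (\<phi> a) + conjugate (\<phi> b \<odot> u)" for a b
      by (simp add: conjugate_def ip_simps algebra_simps)
    then show ?thesis
      by (simp add: \<psi>_def cd_conj_def cj linear_neg[OF lin] mul_simps conj_mul_u)
  qed
  moreover have "e \<in> range \<psi>"
  proof -
    obtain a where "e = \<phi> a"
      using e by auto
    then have "e = \<psi> (a, 0)"
      by (simp add: \<psi>_def linear_0[OF lin] mul_simps)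
    then show ?thesis
      by blast
  qed
  ultimately show ?thesis
    unfolding comp_embedding_def by blast
qed

end

text \<open>The doubling stops at the octonions because their double has zero divisors.\<close>

definition sedenion_mult :: "octonion \<times> octonion \<Rightarrow> octonion \<times> octonion \<Rightarrow> octonion \<times> octonion" where
  "sedenion_mult = cd_mult (cd_conj quat_conj) oct_mult"

lemma sedenion_zero_divisors:
  "sedenion_mult (((\<i>, 0), 0), ((0, 1), 0)) ((0, (1, 0)), (0, (0, - \<i>))) = 0"
  by (simp add: sedenion_mult_def oct_mult_def quat_mult_def quat_conj_def cd_mult_def cd_conj_def
      zero_prod_def)

context composition_algebra
begin

theorem hurwitz:
  "(\<exists>\<phi> :: real \<Rightarrow> 'v. linear \<phi> \<and> bij \<phi> \<and> (\<forall>a b. \<phi> (a * b) = \<phi> a \<odot> \<phi> b)) \<or>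
   (\<exists>\<phi> :: complex \<Rightarrow> 'v. linear \<phi> \<and> bij \<phi> \<and> (\<forall>a b. \<phi> (a * b) = \<phi> a \<odot> \<phi> b)) \<or>
   (\<exists>\<phi> :: quaternion \<Rightarrow> 'v. linear \<phi> \<and> bij \<phi> \<and> (\<forall>a b. \<phi> (quat_mult a b) = \<phi> a \<odot> \<phi> b)) \<or>
   (\<exists>\<phi> :: octonion \<Rightarrow> 'v. linear \<phi> \<and> bij \<phi> \<and> (\<forall>a b. \<phi> (oct_mult a b) = \<phi> a \<odot> \<phi> b))"
  (is "?R \<or> ?C \<or> ?H \<or> ?O")
proof (rule ccontr)
  assume "\<not> (?R \<or> ?C \<or> ?H \<or> ?O)"
  then have none: "\<not> ?R" "\<not> ?C" "\<not> ?H" "\<not> ?O"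
    by simp_all
  have extend: "\<exists>\<psi>. comp_embedding (cd_conj cj) (cd_mult cj m) \<psi>"
    if "comp_embedding cj m \<phi>" "\<not> (\<exists>\<phi>. linear \<phi> \<and> bij \<phi> \<and> (\<forall>a b. \<phi> (m a b) = \<phi> a \<odot> \<phi> b))"
    for cj and m :: "'a::euclidean_space \<Rightarrow> 'a \<Rightarrow> 'a" and \<phi>
  proof -
    have "\<not> surj \<phi>"
      using that comp_embedding_inj[OF that(1)] unfolding comp_embedding_def bij_def by blast
    then show ?thesis
      using comp_embedding_double[OF that(1)] by blast
  qed
  \<comment> \<open>The chain starts with the line through \<open>e\<close>, where conjugation is
    trivial.\<close>
  have real: "comp_embedding (\<lambda>a. a) (*) (\<lambda>a. a *\<^sub>R e)"
    unfolding comp_embedding_def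
    by (auto simp: linear_iff scaleR_add_left mul_simps ip_simps ip_unit conjugate_def image_iff
        simp flip: scaleR_diff_left intro: exI[of _ 1])
  obtain \<psi> where \<psi>: "comp_embedding (cd_conj (\<lambda>a. a)) (cd_mult (\<lambda>a. a) ((*) :: real \<Rightarrow> _)) \<psi>"
    using extend[OF real none(1)] by blast
  \<comment> \<open>The double of the reals lives on pairs; reading a pair as real and imaginary
    part moves it to the type \<open>complex\<close>.\<close>
  have complex: "comp_embedding cnj (*) (\<lambda>z. \<psi> (Re z, Im z))"
    unfolding comp_embedding_def
  proof (intro conjI allI)
    have lin: "linear \<psi>"
      using \<psi> by (simp add: comp_embedding_def)
    show "linear (\<lambda>z. \<psi> (Re z, Im z))"
      using linear_add[OF lin, symmetric] linear_cmul[OF lin, symmetric] by (intro linearI) simp_all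
    have hom: "\<psi> x \<odot> \<psi> y = \<psi> (cd_mult (\<lambda>a. a) (*) x y)" for x y
      using \<psi> unfolding comp_embedding_def by metis
    show "\<psi> (Re (a * b), Im (a * b)) = \<psi> (Re a, Im a) \<odot> \<psi> (Re b, Im b)" for a b
      unfolding hom by (simp add: cd_mult_def algebra_simps)
    show "ip (\<psi> (Re a, Im a)) (\<psi> (Re b, Im b)) = a \<bullet> b" for a b
      using \<psi> by (simp add: comp_embedding_def inner_complex_def)
    have "conjugate (\<psi> x) = \<psi> (cd_conj (\<lambda>a. a) x)" for x
      using \<psi> unfolding comp_embedding_def by metis
    then show "\<psi> (Re (cnj a), Im (cnj a)) = conjugate (\<psi> (Re a, Im a))" for a
      by (simp add: cd_conj_def)
    obtain a b where "e = \<psi> (a, b)"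
      using \<psi> by (auto simp: comp_embedding_def)
    then show "e \<in> range (\<lambda>z. \<psi> (Re z, Im z))"
      by (intro image_eqI[of _ _ "Complex a b"]) simp_all
  qed
  obtain \<phi> where quat: "comp_embedding quat_conj quat_mult \<phi>"
    using extend[OF complex none(2)] unfolding quat_conj_def quat_mult_def by blast
  obtain \<phi> where oct: "comp_embedding (cd_conj quat_conj) oct_mult \<phi>"
    using extend[OF quat none(3)] unfolding oct_mult_def by blast
  obtain \<phi> where "comp_embedding (cd_conj (cd_conj quat_conj)) sedenion_mult \<phi>"
    using extend[OF oct none(4)] unfolding sedenion_mult_def by blast
  \<comment> \<open>Both factors have squared length 2, so their product would have squared length
    4, yet it is zero.\<close>
  from comp_embedding_norm_mul[OF this, of "(((\<i>, 0), 0), ((0, 1), 0))" "((0, (1, 0)), (0, (0, - \<i>)))"]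
  show False
    unfolding sedenion_zero_divisors by simp
qed

end


text \<open>Needed because the triality algebra multiplies by the index on the left, whereas in the
  classical trialities the index is the right-hand factor.\<close>

lemma (in composition_algebra) composition_algebra_op: "composition_algebra ip (\<lambda>x y. y \<odot> x) e"
proof
  show "bilinear (\<lambda>x y. y \<odot> x)"
    using bilinear_mul by (simp add: bilinear_def)
qed (simp_all add: unit_left unit_right unit_nonzero ip_mul mult.commute)

section \<open>The four classical algebras as composition algebras\<close>

text \<open>Expanding the squared norm of the product leaves two cross terms of opposite sign. By
  the adjoint laws and associativity of \<open>m\<close> both equal the pairing of \<open>b\<close>
  with \<open>m d (m a c)\<close>, so they cancel.\<close>

lemma cayley_dickson_composition_algebra:
  fixes m :: "'a::euclidean_space \<Rightarrow> 'a \<Rightarrow> 'a"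
  assumes "composition_algebra (\<bullet>) m e"
    and assoc: "\<And>x y z. m (m x y) z = m x (m y z)"
    and cj: "\<And>x. cj x = (2 * (x \<bullet> e)) *\<^sub>R e - x"
  shows "composition_algebra (\<bullet>) (cd_mult cj m) (e, 0)"
proof -
  interpret composition_algebra "(\<bullet>)" m e
    by (rule assms(1))
  have cj_conj: "cj = conjugate"
    by (auto simp: cj conjugate_def)
  have conj_lin: "conjugate (x + y) = conjugate x + conjugate y" "conjugate (c *\<^sub>R x) = c *\<^sub>R conjugate x" for x y c
    by (simp_all add: conjugate_def ip_simps algebra_simps)
  have conj_e: "conjugate e = e"
    by (simp add: conjugate_def ip_unit algebra_simps flip: scaleR_2)
  have norm_conj: "conjugate x \<bullet> conjugate x = x \<bullet> x" for x
    by (simp add: ip_conjugate_left conjugate_conjugate)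
  interpret prod: positive_form "(\<bullet>) :: 'a \<times> 'a \<Rightarrow> _"
    by (rule positive_form_inner)
  show ?thesis
    unfolding cj_conj
  proof
    show "bilinear (cd_mult conjugate m)"
      by (auto simp: bilinear_def cd_mult_def conj_lin mul_simps algebra_simps split: prod.split intro!: linearI)
    show "cd_mult conjugate m (e, 0) x = x" "cd_mult conjugate m x (e, 0) = x" for x
      by (cases x; simp add: cd_mult_def mul_simps conj_e conj_lin(2)[of 0 0, simplified])+
    show "(e, 0) \<noteq> (0 :: 'a \<times> 'a)"
      using unit_nonzero by (simp add: zero_prod_def)
    show "cd_mult conjugate m x y \<bullet> cd_mult conjugate m x y = (x \<bullet> x) * (y \<bullet> y)" for x y
    proof -
      obtain a b c d where xy: "x = (a, b)" "y = (c, d)"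
        by (metis surj_pair)
      have "m a c \<bullet> m (conjugate d) b = b \<bullet> m d (m a c)"
        using ip_left_adjoint[of "conjugate d" b "m a c"] by (simp add: conjugate_conjugate inner_commute)
      moreover have "m d a \<bullet> m b (conjugate c) = b \<bullet> m d (m a c)"
        using ip_right_adjoint[of b "conjugate c" "m d a"] by (simp add: conjugate_conjugate inner_commute assoc)
      ultimately show ?thesis
        using inner_commute[of "m (conjugate d) b" "m a c"] inner_commute[of "m b (conjugate c)" "m d a"]
        by (simp add: xy cd_mult_def inner_prod_def ip_simps ip_mul norm_conj algebra_simps)
    qed
  qed
qed

lemma composition_algebra_real: "composition_algebra (\<bullet>) (*) (1 :: real)"
proof -
  interpret positive_form "(\<bullet>) :: real \<Rightarrow> _"
    by (rule positive_form_inner)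
  show ?thesis
    by unfold_locales (simp_all add: bilinear_times)
qed

lemma composition_algebra_complex: "composition_algebra (\<bullet>) (*) (1 :: complex)"
proof -
  interpret positive_form "(\<bullet>) :: complex \<Rightarrow> _"
    by (rule positive_form_inner)
  show ?thesis
    by unfold_locales (simp_all add: bilinear_times inner_complex_def algebra_simps)
qed

lemma composition_algebra_quaternion: "composition_algebra (\<bullet>) quat_mult (1, 0)"
  unfolding quat_mult_def
  by (rule cayley_dickson_composition_algebra[OF composition_algebra_complex])
    (simp_all add: complex_eq_iff inner_complex_def algebra_simps)

lemma quat_mult_assoc: "quat_mult (quat_mult x y) z = quat_mult x (quat_mult y z)"
  by (simp add: quat_mult_def cd_mult_def split: prod.split) (simp add: algebra_simps)

lemma composition_algebra_octonion: "composition_algebra (\<bullet>) oct_mult ((1, 0), 0)"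
  unfolding oct_mult_def
  by (rule cayley_dickson_composition_algebra[OF composition_algebra_quaternion])
    (simp_all add: quat_mult_assoc quat_conj_def cd_conj_def complex_eq_iff inner_complex_def inner_prod_def prod_eq_iff)


section \<open>Trialities\<close>

lemma linear_inv:
  fixes f :: "'a::real_vector \<Rightarrow> 'b::real_vector"
  assumes "linear f" "bij f"
  shows "linear (inv f)"
proof (rule linearI)
  have inj: "inj f" and f_inv: "f (inv f y) = y" for y
    using assms(2) by (auto simp: bij_def surj_f_inv_f)
  show "inv f (x + y) = inv f x + inv f y" for x y
    by (rule injD[OF inj]) (simp add: f_inv linear_add[OF assms(1)])
  show "inv f (c *\<^sub>R x) = c *\<^sub>R inv f x" for c x
    by (rule injD[OF inj]) (simp add: f_inv linear_cmul[OF assms(1)])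
qed

lemma dim_linear_bij:
  fixes f :: "'a::real_vector \<Rightarrow> 'b::real_vector"
  assumes "linear f" "bij f"
  shows "dim (UNIV :: 'a set) = dim (UNIV :: 'b set)"
proof -
  obtain B :: "'a set" where B: "independent B" "span B = UNIV"
    by (metis maximal_independent_subset top.extremum_uniqueI)
  have inj: "inj f"
    using assms(2) by (simp add: bij_def)
  have "independent (f ` B)"
    using linear_independent_injective_image[OF assms(1) B(1)] inj inj_on_subset by blast
  moreover have "span (f ` B) = UNIV"
    using linear_span_image[OF assms(1), of B] B(2) assms(2) by (simp add: bij_def)
  ultimately have "dim (UNIV :: 'b set) = card (f ` B)"
    by (intro dim_eq_card) simp_all
  also have "\<dots> = card B"
    using inj by (intro card_image inj_on_subset[OF inj]) simp
  also have "\<dots> = dim (UNIV :: 'a set)"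
    using B dim_eq_card[of B UNIV] by simp
  finally show ?thesis ..
qed

text \<open>The image of a basis is independent and already of maximal size, so a vector outside the
  range would enlarge it beyond the bound.\<close>

lemma linear_inj_eq_dim_bij:
  fixes f :: "'a::real_vector \<Rightarrow> 'b::real_vector"
  assumes f: "linear f" "inj f"
    and fin: "fin_dim (UNIV :: 'a set)" "fin_dim (UNIV :: 'b set)"
    and dim: "dim (UNIV :: 'a set) = dim (UNIV :: 'b set)"
  shows "bij f"
proof -
  obtain B :: "'a set" where B: "independent B" "span B = UNIV"
    by (metis maximal_independent_subset top.extremum_uniqueI)
  obtain C :: "'b set" where C: "independent C" "span C = UNIV"
    by (metis maximal_independent_subset top.extremum_uniqueI)
  note finite = fin_dim_independent_finite[OF fin(1) B(1)] fin_dim_independent_finite[OF fin(2) C(1)]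
  have card: "card (f ` B) = card C"
    using B C dim dim_eq_card[of B UNIV] dim_eq_card[of C UNIV] card_image[of f B]
      inj_on_subset[OF f(2), of B] by simp
  have indep: "independent (f ` B)"
    using linear_independent_injective_image[OF f(1) B(1)] f(2) inj_on_subset by blast
  have "y \<in> range f" for y
  proof (rule ccontr)
    assume "y \<notin> range f"
    then have y: "y \<notin> span (f ` B)"
      using linear_span_image[OF f(1), of B] B(2) by simp
    then have "independent (insert y (f ` B))"
      using independent_insertI indep by blast
    then have "card (insert y (f ` B)) \<le> card C"
      using independent_span_bound[of C] finite C by blast
    moreover have "y \<notin> f ` B"
      using y span_base[of y "f ` B"] by argo
    ultimately show False
      using card finite by simp
  qed
  then show ?thesis
    using f(2) by (auto simp: bij_def)
qed

section \<open>The triality algebra at a pair of base points\<close>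

locale pointed_triality =
  fixes t :: "'u::real_vector \<Rightarrow> 'v::real_vector \<Rightarrow> 'w::real_vector" and eU :: 'u and eV :: 'v
  assumes triality: "triality t" and eU: "eU \<noteq> 0" and eV: "eV \<noteq> 0"
begin

abbreviation mult :: "'v \<Rightarrow> 'v \<Rightarrow> 'v" where
  "mult \<equiv> triality_mult t eU eV"

abbreviation f :: "'u \<Rightarrow> 'v" where
  "f \<equiv> eps_U t eU eV"

lemma bilinear: "bilinear t"
  using triality by (simp add: triality_def)

lemma bij_t: "u \<noteq> 0 \<Longrightarrow> bij (t u)"
  using triality by (simp add: triality_def)

lemma linear_t: "linear (t u)"
  using bilinear by (simp add: bilinear_def)

lemma t_eq_0: "t u v = 0 \<Longrightarrow> u = 0 \<or> v = 0"
  using bij_t[of u] bilinear_rzero[OF bilinear, of u] by (metis bij_is_inj injD)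

lemma t_inv: "t eU (inv (t eU) w) = w"
  using bij_t[OF eU] by (simp add: bij_def surj_f_inv_f)

lemma eps_V: "eps_V t eU = t eU"
  by (auto simp: eps_V_def)

lemma t_eps: "t eU (f u) = t u eV"
  by (simp add: eps_U_def eps_V t_inv)

lemma linear_eps_U: "linear f"
proof -
  have "linear (\<lambda>u. t u eV)"
    using bilinear by (simp add: bilinear_def)
  from linear_compose[OF this linear_inv[OF linear_t bij_t[OF eU]]]
  show ?thesis
    by (simp add: eps_U_def[abs_def] eps_V o_def)
qed

lemma bij_eps_U: "bij f"
proof (rule linear_inj_eq_dim_bij[OF linear_eps_U])
  show "inj f"
    using t_eps t_eq_0 eV linear_0[OF linear_t]
    by (metis linear_eps_U linear_inj_iff_eq_0)
qed (use triality in \<open>simp_all add: triality_def\<close>)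

text \<open>Describes the product without inverses; together with injectivity of \<open>t eU\<close>
  it reduces identities in the algebra to identities for \<open>t\<close>.\<close>

lemma t_mult: "t eU (mult (f u) v) = t u v"
  using bij_eps_U by (simp add: triality_mult_def eps_V t_inv bij_def)

lemma mult_eq: "mult x y = inv (t eU) (t (inv f x) y)"
  by (simp add: triality_mult_def eps_V)

lemma bilinear_mult: "bilinear mult"
  unfolding bilinear_def mult_eq
proof (intro conjI allI)
  note inv_lin = linear_inv[OF linear_t bij_t[OF eU]]
  show "linear (\<lambda>x. inv (t eU) (t (inv f x) y))" for y
  proof -
    have "linear (\<lambda>u. t u y)"
      using bilinear by (simp add: bilinear_def)
    from linear_compose[OF linear_compose[OF linear_inv[OF linear_eps_U bij_eps_U] this] inv_lin]
    show ?thesis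
      by (simp add: o_def)
  qed
  show "linear (\<lambda>y. inv (t eU) (t (inv f x) y))" for x
    using linear_compose[OF linear_t inv_lin] by (simp add: o_def)
qed

lemma inj_t_eU: "t eU x = t eU y \<Longrightarrow> x = y"
  using bij_t[OF eU] by (simp add: bij_def inj_eq)

lemma f_unit: "f eU = eV"
  by (rule inj_t_eU) (simp add: t_eps)

lemma mult_unit: "mult eV x = x" "mult x eV = x"
proof -
  show "mult eV x = x"
    using t_mult[of eU x] inj_t_eU by (simp add: f_unit)
  obtain u where "x = f u"
    using bij_eps_U by (meson bij_is_surj surjE)
  then show "mult x eV = x"
    using t_mult[of u eV] t_eps[of u] inj_t_eU by simp
qed

lemma mult_eq_0: "mult x y = 0 \<Longrightarrow> x = 0 \<or> y = 0"
proof -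
  assume *: "mult x y = 0"
  obtain u where u: "x = f u"
    using bij_eps_U by (meson bij_is_surj surjE)
  then have "t u y = 0"
    using * t_mult[of u y] linear_0[OF linear_t] by simp
  then show ?thesis
    using t_eq_0 u linear_0[OF linear_eps_U] by blast
qed

text \<open>All three spaces are first identified with \<open>'v\<close>, the outer two through
  \<open>f\<close> and \<open>inv (t eU)\<close>, and then carried over by
  \<open>inv \<phi>\<close>. The factors are swapped in the assumption, so \<phi> is an
  antihomomorphism into \<open>mult\<close>.\<close>

lemma triality_iso_right_mult:
  assumes \<phi>: "linear \<phi>" "bij \<phi>" "\<And>a b. \<phi> (m a b) = mult (\<phi> b) (\<phi> a)"
  shows "triality_iso t (\<lambda>u v. m v u)"
proof -
  note lin = linear_inv[OF \<phi>(1,2)]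
  have bij: "bij (inv \<phi>)"
    using \<phi>(2) by (rule bij_imp_bij_inv)
  have bij_t': "bij (inv (t eU))" "linear (inv (t eU))"
    using bij_imp_bij_inv[OF bij_t[OF eU]] linear_inv[OF linear_t bij_t[OF eU]] by auto
  have \<phi>_inv: "\<phi> (inv \<phi> x) = x" for x
    using \<phi>(2) by (simp add: bij_def surj_f_inv_f)
  have "m (inv \<phi> v) (inv \<phi> (f u)) = inv \<phi> (inv (t eU) (t u v))" for u v
  proof (rule injD[of \<phi>])
    show "inj \<phi>"
      using \<phi>(2) by (simp add: bij_def)
    show "\<phi> (m (inv \<phi> v) (inv \<phi> (f u))) = \<phi> (inv \<phi> (inv (t eU) (t u v)))"
      by (rule inj_t_eU) (simp add: \<phi>(3) \<phi>_inv t_mult t_inv)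
  qed
  moreover have "linear (inv \<phi> \<circ> f)" "bij (inv \<phi> \<circ> f)"
    using linear_compose[OF linear_eps_U lin] bij_comp[OF bij_eps_U bij] by auto
  moreover have "linear (inv \<phi> \<circ> inv (t eU))" "bij (inv \<phi> \<circ> inv (t eU))"
    using linear_compose[OF bij_t'(2) lin] bij_comp[OF bij_t'(1) bij] by auto
  ultimately show ?thesis
    using lin bij unfolding triality_iso_def
    by (intro exI[of _ "inv \<phi> \<circ> f"] exI[of _ "inv \<phi>"] exI[of _ "inv \<phi> \<circ> inv (t eU)"]) simp
qed

lemma classical_triality_if_classical_algebra:
  assumes "classical_algebra mult"
  shows "classical_triality t"
proof -
  have "fin_dim (UNIV :: 'v set)"
    using triality by (simp add: triality_def)
  then obtain ip where ip: "composition_algebra ip mult eV"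
    using classical_division_algebra_is_composition_algebra[of mult eV]
      bilinear_mult mult_unit eV mult_eq_0 assms by blast
  note op = composition_algebra.composition_algebra_op[OF ip]
  have "\<exists>A. iso_right_mult t A"
    using composition_algebra.hurwitz[OF op]
  proof (elim disjE exE conjE)
    fix \<phi> :: "real \<Rightarrow> 'v"
    assume "linear \<phi>" "bij \<phi>" "\<forall>a b. \<phi> (a * b) = mult (\<phi> b) (\<phi> a)"
    then have "iso_right_mult t Real_Alg"
      unfolding iso_right_mult.simps by (intro triality_iso_right_mult[of \<phi>]) blast+
    then show ?thesis ..
  next
    fix \<phi> :: "complex \<Rightarrow> 'v"
    assume "linear \<phi>" "bij \<phi>" "\<forall>a b. \<phi> (a * b) = mult (\<phi> b) (\<phi> a)"
    then have "iso_right_mult t Complex_Alg"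
      unfolding iso_right_mult.simps by (intro triality_iso_right_mult[of \<phi>]) blast+
    then show ?thesis ..
  next
    fix \<phi> :: "quaternion \<Rightarrow> 'v"
    assume "linear \<phi>" "bij \<phi>" "\<forall>a b. \<phi> (quat_mult a b) = mult (\<phi> b) (\<phi> a)"
    then have "iso_right_mult t Quaternion_Alg"
      unfolding iso_right_mult.simps by (intro triality_iso_right_mult[of \<phi>]) blast+
    then show ?thesis ..
  next
    fix \<phi> :: "octonion \<Rightarrow> 'v"
    assume "linear \<phi>" "bij \<phi>" "\<forall>a b. \<phi> (oct_mult a b) = mult (\<phi> b) (\<phi> a)"
    then have "iso_right_mult t Octonion_Alg"
      unfolding iso_right_mult.simps by (intro triality_iso_right_mult[of \<phi>]) blast+
    then show ?thesis ..
  qed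
  then show ?thesis
    by (simp add: classical_triality_def)
qed

text \<open>The isomorphism need not match the base points with \<open>e\<close>, so
  \<open>mult\<close> need not be transported to \<open>m\<close>. What survives is multiplicativity
  of the pulled-back norms on the three spaces, and this suffices.\<close>

lemma classical_algebra_if_iso_composition:
  fixes m :: "'a::euclidean_space \<Rightarrow> 'a \<Rightarrow> 'a"
  assumes m: "composition_algebra (\<bullet>) m e" and iso: "triality_iso t (\<lambda>u v. m v u)"
  shows "classical_algebra mult"
proof -
  interpret m: composition_algebra "(\<bullet>)" m e
    by (rule m)
  obtain gU gV gW where g: "linear gU" "bij gU" "linear gV" "bij gV" "linear gW" "bij gW"
      "\<And>u v. m (gV v) (gU u) = gW (t u v)"
    using iso unfolding triality_iso_def by blast
  have t_norm: "gW (t u v) \<bullet> gW (t u v) = (gV v \<bullet> gV v) * (gU u \<bullet> gU u)" for u v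
    by (simp add: m.ip_mul flip: g(7))
  have nonzero: "gU eU \<bullet> gU eU > 0" "gV x \<bullet> gV x > 0" if "x \<noteq> 0" for x
    using g eU that by (metis bij_def inner_gt_zero_iff linear_inj_iff_eq_0)+
  \<comment> \<open>Rescales the norm on \<open>'v\<close> so that \<open>eV\<close> has length
    one.\<close>
  define k where "k = inverse (gV eV \<bullet> gV eV)"
  have k: "k > 0" "k * (gV eV \<bullet> gV eV) = 1"
    using nonzero(2)[OF eV] by (auto simp: k_def)
  define ip where "ip x y = k * (gV x \<bullet> gV y)" for x y
  have "composition_algebra ip mult eV"
  proof
    show "bilinear ip"
      by (auto simp: bilinear_def ip_def linear_add[OF g(3)] linear_cmul[OF g(3)] inner_add_left
          inner_add_right algebra_simps intro!: linearI)
    show "ip x y = ip y x" for x y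
      by (simp add: ip_def inner_commute)
    show "ip x x > 0" if "x \<noteq> 0" for x
      using nonzero(2)[OF that] k by (simp add: ip_def)
    show "ip (mult x y) (mult x y) = ip x x * ip y y" for x y
    proof -
      obtain u where u: "x = f u"
        using bij_eps_U by (meson bij_is_surj surjE)
      \<comment> \<open>Two readings of \<open>t_norm\<close>: this one compares
        \<open>t eU (mult x y)\<close> with \<open>t u y\<close>; the next compares
        \<open>t eU x\<close> with \<open>t u eV\<close> and expresses the length of
        \<open>u\<close> through that of \<open>x\<close>. The common factor from \<open>eU\<close>
        then cancels.\<close>
      have "(gV (mult x y) \<bullet> gV (mult x y)) * (gU eU \<bullet> gU eU) = (gV y \<bullet> gV y) * (gU u \<bullet> gU u)"
        using t_norm[of eU "mult x y"] t_norm[of u y] by (simp add: u t_mult)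
      moreover have "(gV x \<bullet> gV x) * (gU eU \<bullet> gU eU) = (gV eV \<bullet> gV eV) * (gU u \<bullet> gU u)"
        using t_norm[of eU x] t_norm[of u eV] by (simp add: u t_eps)
      then have "gU u \<bullet> gU u = k * (gV x \<bullet> gV x) * (gU eU \<bullet> gU eU)"
        using k(2) by (metis mult.assoc mult_1)
      ultimately have "(gV (mult x y) \<bullet> gV (mult x y)) * (gU eU \<bullet> gU eU) =
          (gV y \<bullet> gV y) * (k * (gV x \<bullet> gV x)) * (gU eU \<bullet> gU eU)"
        by simp
      then have "gV (mult x y) \<bullet> gV (mult x y) = (gV y \<bullet> gV y) * (k * (gV x \<bullet> gV x))"
        using nonzero(1)[OF eV] by (metis less_irrefl mult_right_cancel)
      then show ?thesis
        by (simp add: ip_def)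
    qed
  qed (use bilinear_mult mult_unit eV in auto)
  then show ?thesis
    using composition_algebra.classical_mul triality unfolding triality_def by blast
qed

lemma classical_algebra_iff: "classical_algebra mult \<longleftrightarrow> classical_triality t"
proof
  assume "classical_triality t"
  then obtain A where "iso_right_mult t A"
    by (auto simp: classical_triality_def)
  then show "classical_algebra mult"
    by (cases A)
      (auto intro: classical_algebra_if_iso_composition composition_algebra_real
        composition_algebra_complex composition_algebra_quaternion composition_algebra_octonion)
qed (rule classical_triality_if_classical_algebra)

end

section \<open>Uniqueness of the classical model\<close>

lemma triality_iso_dim:
  fixes t :: "'u::real_vector \<Rightarrow> 'v::real_vector \<Rightarrow> 'w::real_vector"
    and t' :: "'a::real_vector \<Rightarrow> 'b::euclidean_space \<Rightarrow> 'c::real_vector"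
  assumes "triality_iso t t'"
  shows "dim (UNIV :: 'v set) = DIM('b)"
proof -
  obtain gV :: "'v \<Rightarrow> 'b" where "linear gV" "bij gV"
    using assms unfolding triality_iso_def by (elim exE conjE) (rule that)
  from dim_linear_bij[OF this] show ?thesis
    by (simp only: dim_UNIV)
qed

lemma iso_right_mult_dim:
  fixes t :: "'u::real_vector \<Rightarrow> 'v::real_vector \<Rightarrow> 'w::real_vector"
  assumes "iso_right_mult t A"
  shows "dim (UNIV :: 'v set) =
    (case A of Real_Alg \<Rightarrow> 1 | Complex_Alg \<Rightarrow> 2 | Quaternion_Alg \<Rightarrow> 4 | Octonion_Alg \<Rightarrow> 8)"
  using assms by (cases A) (auto dest!: triality_iso_dim)

text \<open>The dimensions 1, 2, 4 and 8 are distinct invariants of the four models.\<close>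

lemma iso_right_mult_unique:
  assumes "iso_right_mult t A" "iso_right_mult t B"
  shows "A = B"
  using trans[OF iso_right_mult_dim[OF assms(1), symmetric] iso_right_mult_dim[OF assms(2)]]
  by (cases A; cases B) simp_all

theorem lemma23:
  fixes t :: "'u::real_vector \<Rightarrow> 'v::real_vector \<Rightarrow> 'w::real_vector"
  assumes "triality t"
  shows "(\<forall>eU eV. eU \<noteq> 0 \<longrightarrow> eV \<noteq> 0 \<longrightarrow>
             (classical_algebra (triality_mult t eU eV) \<longleftrightarrow> classical_triality t) \<and>
             (classical_triality t \<longleftrightarrow> (\<exists>!A. iso_right_mult t A)))
       \<and> (\<forall>eU eV eU' eV'. eU \<noteq> 0 \<longrightarrow> eV \<noteq> 0 \<longrightarrow> eU' \<noteq> 0 \<longrightarrow> eV' \<noteq> 0 \<longrightarrow>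
             (classical_algebra (triality_mult t eU eV) \<longleftrightarrow>
              classical_algebra (triality_mult t eU' eV')))"
proof -
  have "classical_algebra (triality_mult t eU eV) \<longleftrightarrow> classical_triality t"
    if "eU \<noteq> 0" "eV \<noteq> 0" for eU eV
    using assms that by (intro pointed_triality.classical_algebra_iff) (simp add: pointed_triality_def)
  moreover have "classical_triality t \<longleftrightarrow> (\<exists>!A. iso_right_mult t A)"
    unfolding classical_triality_def using iso_right_mult_unique[of t] by blast
  \<comment> \<open>The second claim follows since \<open>classical_triality t\<close> does not
    mention the base points.\<close>
  ultimately show ?thesis
    by blast
qed

end
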